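(* Let $E$ be an arbitrary directed graph. The following conditions are equivalent. (1) Every nonzero element $a\in F_E^\Gamma$ is incomparable. (2) Every generator of $F_E^\Gamma$ is incomparable. (3) The graph $E$ is acyclic (it has no cycles).
   Context: Setup. $\Gamma=\{x^n\mid n\in\mathbb Z\}$ is the infinite cyclic group generated by $x$. $E$ is an arbitrary directed graph with vertex set $E^0$, edge set $E^1$, source map $\mathbf s$ and range map $\mathbf r$. A vertex $v$ is regular if $\mathbf s^{-1}(v)$ is finite and nonempty, and an infinite emitter if $\mathbf s^{-1}(v)$ is infinite. For every infinite emitter $v$ and every finite nonempty $Z\subseteq \mathbf s^{-1}(v)$ introduce a symbol $q_Z=q_Z^v$, called an improper vertex; elements of $E^0$ are called proper vertices. $F_E^\Gamma$ is the free commutative $\Gamma$-monoid on all proper and improper vertices (these are called the generators): its elements are finite formal sums of monomials $x^m g$ ($m\in\mathbb Z$, $g$ a generator), and $x^n$ acts by $x^n(x^m g)=x^{n+m}g$. The relation $\to_1$ on $F_E^\Gamma-\{0\}$ is given, for all $a\in F_E^\Gamma$ and $m\in\mathbb Z$, by: (A1) $a+x^m v\to_1 a+\sum_{e\in \mathbf s^{-1}(v)}x^{m+1}\mathbf r(e)$ for $v$ regular; (A2) $a+x^m v\to_1 a+x^m q_Z+\sum_{e\in Z}x^{m+1}\mathbf r(e)$ for $v$ an infinite emitter and $Z\subseteq \mathbf s^{-1}(v)$ finite and nonempty; (A3) $a+x^m q_Z\to_1 a+x^m q_W+\sum_{e\in W-Z}x^{m+1}\mathbf r(e)$ for $v$ an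 infinite emitter and finite nonempty $Z\subsetneq W\subseteq \mathbf s^{-1}(v)$. $\sim$ is the congruence on $F_E^\Gamma$ generated by $\to_1$. For $a,b\in F_E^\Gamma$, $a\precsim b$ means that $a+c\sim b$ for some $c\in F_E^\Gamma$. An element $a$ is incomparable if for every positive integer $n$ neither $a\precsim x^n a$ nor $x^n a\precsim a$ holds. A cycle is a closed path $e_1\cdots e_n$, $n\geq 1$, with $\mathbf s(e_i)\neq \mathbf s(e_j)$ for $i\ne j$. *)

theory Defs
  imports "Graph_Theory.Arc_Walk" "HOL-Library.Multiset"
begin

text \<open>
  A directed graph with vertex set \<open>verts E\<close>, edge set \<open>arcs E\<close>, source map \<open>tail E\<close> and range map
  \<open>head E\<close> is a \<open>pre_digraph\<close> satisfying \<open>wf_digraph\<close>. The set of edges with source \<open>v\<close> is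
  \<open>out_arcs E v\<close>.
\<close>

definition regular_vertex :: "('v, 'e) pre_digraph \<Rightarrow> 'v \<Rightarrow> bool" where
  "regular_vertex E v \<longleftrightarrow> v \<in> verts E \<and> finite (out_arcs E v) \<and> out_arcs E v \<noteq> {}"

definition infinite_emitter :: "('v, 'e) pre_digraph \<Rightarrow> 'v \<Rightarrow> bool" where
  "infinite_emitter E v \<longleftrightarrow> v \<in> verts E \<and> infinite (out_arcs E v)"

text \<open>\<open>Improper v Z\<close> stands for the symbol \<open>q\<^sub>Z\<close> attached to \<open>v\<close>.\<close>

datatype ('v, 'e) vertex_symbol = Proper 'v | Improper 'v "'e set"

definition gens :: "('v, 'e) pre_digraph \<Rightarrow> ('v, 'e) vertex_symbol set" where
  "gens E = Proper ` verts E \<union>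
     {Improper v Z | v Z. infinite_emitter E v \<and> finite Z \<and> Z \<noteq> {} \<and> Z \<subseteq> out_arcs E v}"

text \<open>
  A monomial \<open>x\<^sup>m g\<close> is the pair \<open>(m, g)\<close>, so that the group generated by \<open>x\<close> is written additively
  as the integers, and a finite formal sum of monomials is a multiset of such pairs.
\<close>

type_synonym ('v, 'e) formal_sum = "(int \<times> ('v, 'e) vertex_symbol) multiset"

definition monomial :: "int \<Rightarrow> ('v, 'e) vertex_symbol \<Rightarrow> ('v, 'e) formal_sum" where
  "monomial m g = {#(m, g)#}"

definition free_gamma_monoid :: "('v, 'e) pre_digraph \<Rightarrow> ('v, 'e) formal_sum set" where
  "free_gamma_monoid E = {a. set_mset a \<subseteq> UNIV \<times> gens E}"

definition act :: "int \<Rightarrow> ('v, 'e) formal_sum \<Rightarrow> ('v, 'e) formal_sum" where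
  "act n a = image_mset (\<lambda>(m, g). (n + m, g)) a"

inductive arrow1 :: "('v, 'e) pre_digraph \<Rightarrow> ('v, 'e) formal_sum \<Rightarrow> ('v, 'e) formal_sum \<Rightarrow> bool"
  for E :: "('v, 'e) pre_digraph" where
  A1: "a \<in> free_gamma_monoid E \<Longrightarrow> regular_vertex E v \<Longrightarrow>
       arrow1 E (a + monomial m (Proper v))
                (a + (\<Sum>e\<in>out_arcs E v. monomial (m + 1) (Proper (head E e))))"
| A2: "a \<in> free_gamma_monoid E \<Longrightarrow> infinite_emitter E v \<Longrightarrow>
       finite Z \<Longrightarrow> Z \<noteq> {} \<Longrightarrow> Z \<subseteq> out_arcs E v \<Longrightarrow>
       arrow1 E (a + monomial m (Proper v))
                (a + monomial m (Improper v Z) + (\<Sum>e\<in>Z. monomial (m + 1) (Proper (head E e))))"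
| A3: "a \<in> free_gamma_monoid E \<Longrightarrow> infinite_emitter E v \<Longrightarrow>
       finite Z \<Longrightarrow> Z \<noteq> {} \<Longrightarrow> finite W \<Longrightarrow> Z \<subset> W \<Longrightarrow> W \<subseteq> out_arcs E v \<Longrightarrow>
       arrow1 E (a + monomial m (Improper v Z))
                (a + monomial m (Improper v W) + (\<Sum>e\<in>W - Z. monomial (m + 1) (Proper (head E e))))"

text \<open>
  The least equivalence relation on \<open>free_gamma_monoid E\<close> that contains \<open>arrow1 E\<close> and is compatible
  with the \<open>\<Gamma>\<close>-monoid structure. The rule \<open>act\<close> is redundant, since \<open>arrow1 E\<close> is itself invariant
  under the action.
\<close>

inductive gcong :: "('v, 'e) pre_digraph \<Rightarrow> ('v, 'e) formal_sum \<Rightarrow> ('v, 'e) formal_sum \<Rightarrow> bool"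
  for E :: "('v, 'e) pre_digraph" where
  step: "arrow1 E a b \<Longrightarrow> gcong E a b"
| refl: "a \<in> free_gamma_monoid E \<Longrightarrow> gcong E a a"
| sym: "gcong E a b \<Longrightarrow> gcong E b a"
| trans: "gcong E a b \<Longrightarrow> gcong E b c \<Longrightarrow> gcong E a c"
| add: "gcong E a b \<Longrightarrow> gcong E c d \<Longrightarrow> gcong E (a + c) (b + d)"
| act: "gcong E a b \<Longrightarrow> gcong E (act n a) (act n b)"

definition precsim :: "('v, 'e) pre_digraph \<Rightarrow> ('v, 'e) formal_sum \<Rightarrow> ('v, 'e) formal_sum \<Rightarrow> bool" where
  "precsim E a b \<longleftrightarrow> (\<exists>c \<in> free_gamma_monoid E. gcong E (a + c) b)"

definition incomparable :: "('v, 'e) pre_digraph \<Rightarrow> ('v, 'e) formal_sum \<Rightarrow> bool" where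
  "incomparable E a \<longleftrightarrow>
     (\<forall>n::nat. n > 0 \<longrightarrow> \<not> precsim E a (act (int n) a) \<and> \<not> precsim E (act (int n) a) a)"

definition acyclic_digraph :: "('v, 'e) pre_digraph \<Rightarrow> bool" where
  "acyclic_digraph E \<longleftrightarrow> (\<nexists>p. pre_digraph.cycle E p)"

text \<open>
  The predicate \<open>pre_digraph.cycle\<close> asks for the edges of a nonempty closed walk to have distinct ranges; on a
  closed walk this says that they have distinct sources.
\<close>

lemma (in wf_digraph) cycle_iff_distinct_sources:
  "cycle p \<longleftrightarrow> (\<exists>u. awalk u p u \<and> p \<noteq> [] \<and> distinct (map (tail G) p))"
proof -
  have "distinct (tl (awalk_verts u p)) \<longleftrightarrow> distinct (map (tail G) p)"
    if w: "awalk u p u" and ne: "p \<noteq> []" for u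
  proof -
    have c: "cas u p u" using w by blast
    have h: "awalk_verts u p = tail G (hd p) # map (head G) p"
      using awalk_verts_conv'[OF c] ne by simp
    have t: "awalk_verts u p = map (tail G) p @ [head G (last p)]"
      using awalk_verts_conv[of u p] ne by simp
    have l: "head G (last p) = u" and f: "tail G (hd p) = u"
      using w ne h t by (auto simp: awalk_conv last_map)
    have "mset (u # map (head G) p) = mset (map (tail G) p @ [u])"
      using h t l f by metis
    then have "mset (map (head G) p) = mset (map (tail G) p)" by simp
    then show ?thesis using h by (metis list.sel(3) mset_eq_imp_distinct_iff)
  qed
  then show ?thesis unfolding cycle_def by blast
qed

lemma (in wf_digraph) gcong_closed:
  assumes "gcong G a b"
  shows "a \<in> free_gamma_monoid G \<and> b \<in> free_gamma_monoid G"
proof -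
  have sums: "(\<Sum>e\<in>Z. monomial m (Proper (head G e))) \<in> free_gamma_monoid G"
    if "Z \<subseteq> arcs G" for Z m
    using that
    by (induction Z rule: infinite_finite_induct)
      (auto simp: free_gamma_monoid_def monomial_def gens_def)
  have plus: "c + d \<in> free_gamma_monoid G"
    if "c \<in> free_gamma_monoid G" "d \<in> free_gamma_monoid G" for c d
    using that by (auto simp: free_gamma_monoid_def)
  have mon: "monomial m g \<in> free_gamma_monoid G" if "g \<in> gens G" for m g
    using that by (simp add: free_gamma_monoid_def monomial_def)
  have proper: "Proper v \<in> gens G" if "regular_vertex G v \<or> infinite_emitter G v" for v
    using that by (auto simp: gens_def regular_vertex_def infinite_emitter_def)
  have improp: "Improper v Z \<in> gens G"
    if "infinite_emitter G v" "finite Z" "Z \<noteq> {}" "Z \<subseteq> out_arcs G v" for v Z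
    using that by (auto simp: gens_def)
  have out: "Z \<subseteq> arcs G" if "Z \<subseteq> out_arcs G v" for Z v
    using that by (auto simp: out_arcs_def)
  have arr: "a \<in> free_gamma_monoid G \<and> b \<in> free_gamma_monoid G" if "arrow1 G a b" for a b
    using that
  proof cases
    case (A1 a v m)
    then show ?thesis by (metis plus mon proper sums out order_refl)
  next
    case (A2 a v Z m)
    then show ?thesis by (metis plus mon proper improp sums out)
  next
    case (A3 a v Z W m)
    have "Z \<subseteq> out_arcs G v" "W - Z \<subseteq> out_arcs G v" "W \<noteq> {}" using A3 by auto
    with A3 show ?thesis by (metis plus mon improp sums out)
  qed
  from assms show ?thesis
    by induction (use arr in \<open>auto simp: free_gamma_monoid_def act_def\<close>)
qed

end

theory Submission
  imports Defs
begin

text \<open>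
  An edge \<open>e\<close> gives \<open>x r(e) \<precsim> s(e)\<close>, so a cycle of length \<open>n\<close> through \<open>v\<close> gives \<open>x\<^sup>n v \<precsim> v\<close>.

  Conversely, let \<open>E\<close> be acyclic and \<open>t > 0\<close>. A derivation of \<open>a \<sim> b\<close> involves only finitely many
  edges, and for every large enough finite set \<open>A\<close> of edges there is an additive function \<open>\<phi>\<close> that takes
  positive values on the generators, satisfies \<open>\<phi>(x\<^sup>n a) = t\<^sup>n \<phi>(a)\<close>, and respects all relations used:
  it is obtained by well-founded recursion along \<open>A\<close>. With \<open>t < 1\<close> this contradicts
  \<open>a \<precsim> x\<^sup>n a\<close>, and with \<open>t > 1\<close> it contradicts \<open>x\<^sup>n a \<precsim> a\<close>.
\<close>

section \<open>The preorder along walks\<close>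

lemma free_gamma_monoid_add_iff:
  "a + b \<in> free_gamma_monoid E \<longleftrightarrow> a \<in> free_gamma_monoid E \<and> b \<in> free_gamma_monoid E"
  by (auto simp: free_gamma_monoid_def)

lemma monomial_in_free_gamma_monoid [simp]:
  "monomial m g \<in> free_gamma_monoid E \<longleftrightarrow> g \<in> gens E"
  by (simp add: free_gamma_monoid_def monomial_def)

lemma precsim_trans:
  assumes "precsim E a b" "precsim E b c"
  shows "precsim E a c"
proof -
  obtain d where d: "d \<in> free_gamma_monoid E" "gcong E (a + d) b"
    using assms(1) unfolding precsim_def by blast
  obtain d' where d': "d' \<in> free_gamma_monoid E" "gcong E (b + d') c"
    using assms(2) unfolding precsim_def by blast
  have "gcong E (a + (d + d')) (b + d')"
    using gcong.add[OF d(2) gcong.refl[OF d'(1)]] by (simp add: add.assoc)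
  then show ?thesis
    unfolding precsim_def using d(1) d' by (metis gcong.trans free_gamma_monoid_add_iff)
qed

context wf_digraph
begin

lemma arrow1_imp_precsim:
  assumes "arrow1 G b (a + c)"
  shows "precsim G a b"
proof -
  have "gcong G b (a + c)" using assms by (rule gcong.step)
  moreover from this have "c \<in> free_gamma_monoid G"
    using gcong_closed by (metis free_gamma_monoid_add_iff)
  ultimately show ?thesis unfolding precsim_def by (metis gcong.sym)
qed

text \<open>A regular source is expanded by A1, and the ranges of the edges other than
  \<open>e\<close> are the slack. At an infinite emitter A2 with Z = {e} leaves the improper vertex
  as slack.\<close>

lemma precsim_arc:
  assumes e: "e \<in> arcs G"
  shows "precsim G (monomial (m + 1) (Proper (head G e))) (monomial m (Proper (tail G e)))"
proof (cases "finite (out_arcs G (tail G e))")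
  case True
  have mem: "e \<in> out_arcs G (tail G e)" using e by simp
  then have "regular_vertex G (tail G e)" using True e by (auto simp: regular_vertex_def)
  from arrow1.A1[OF _ this, of "{#}" m]
  have "arrow1 G (monomial m (Proper (tail G e)))
          (\<Sum>e'\<in>out_arcs G (tail G e). monomial (m + 1) (Proper (head G e')))"
    by (simp add: free_gamma_monoid_def)
  then show ?thesis
    by (subst (asm) sum.remove[OF True mem]) (rule arrow1_imp_precsim)
next
  case False
  then have "infinite_emitter G (tail G e)" using e by (auto simp: infinite_emitter_def)
  from arrow1.A2[OF _ this, of "{#}" "{e}" m]
  have "arrow1 G (monomial m (Proper (tail G e)))
      (monomial m (Improper (tail G e) {e}) + monomial (m + 1) (Proper (head G e)))"
    using e by (simp add: free_gamma_monoid_def)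
  then show ?thesis by (subst (asm) add.commute) (rule arrow1_imp_precsim)
qed

lemma precsim_awalk:
  assumes "awalk u p v"
  shows "precsim G (monomial (m + int (length p)) (Proper v)) (monomial m (Proper u))"
  using assms
\<comment> \<open>The exponent must vary, as the walk after its first edge starts one degree
  higher.\<close>
proof (induction p arbitrary: u m)
  case Nil
  then have "u = v" "u \<in> verts G" by (auto simp: awalk_Nil_iff)
  then have "gcong G (monomial m (Proper v) + {#}) (monomial m (Proper u))"
    by (auto intro!: gcong.refl simp: gens_def)
  moreover have "{#} \<in> free_gamma_monoid G" by (simp add: free_gamma_monoid_def)
  ultimately show ?case unfolding precsim_def by (auto intro!: bexI[of _ "{#}"])
next
  case (Cons e p)
  from Cons.prems have e: "e \<in> arcs G" "u = tail G e" and p: "awalk (head G e) p v"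
    by (auto simp: awalk_Cons_iff)
  show ?case
    using precsim_trans[OF Cons.IH[OF p, of "m + 1"] precsim_arc[OF e(1), of m]] e(2)
    by (simp add: add.assoc)
qed

lemma not_incomparable_cycle:
  assumes "awalk u p u" "p \<noteq> []"
  shows "\<not> incomparable G (monomial 0 (Proper u))"
proof -
  have "precsim G (act (int (length p)) (monomial 0 (Proper u))) (monomial 0 (Proper u))"
    using precsim_awalk[OF assms(1), of 0] by (simp add: act_def monomial_def)
  then show ?thesis using assms(2) unfolding incomparable_def by (metis length_greater_0_conv)
qed

section \<open>Weights attached to a finite set of edges\<close>

lemma wf_finite_arcs:
  assumes "acyclic_digraph G" "finite A" "A \<subseteq> arcs G"
  shows "wf ((\<lambda>e. (head G e, tail G e)) ` A)"
\<comment> \<open>An acyclic graph may contain infinite paths; finiteness of \<open>A\<close> turns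
  acyclicity into well-foundedness, with the range of an edge below its source.\<close>
proof (rule finite_acyclic_wf)
  show "finite ((\<lambda>e. (head G e, tail G e)) ` A)" using assms(2) by simp
  have "acyclic (arcs_ends G)"
  proof (rule acyclicI, intro allI notI)
    fix u assume "(u, u) \<in> (arcs_ends G)\<^sup>+"
    then obtain p where "awalk u p u" "p \<noteq> []" using reachable1_awalk by blast
    then have "closed_w p" by (auto simp: closed_w_def)
    then show False using closed_w_imp_cycle assms(1) by (auto simp: acyclic_digraph_def)
  qed
  moreover have "(\<lambda>e. (head G e, tail G e)) ` A \<subseteq> (arcs_ends G)\<inverse>"
    using assms(3) by (auto simp: arcs_ends_def arc_to_ends_def)
  ultimately show "acyclic ((\<lambda>e. (head G e, tail G e)) ` A)"
    using acyclic_subset acyclic_converse by blast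
qed

end

text \<open>The value 0 lets A1 hold exactly at a regular vertex whose edges all lie in
  \<open>A\<close>. The value 1 keeps vertices without edges in \<open>A\<close> positive, and at an
  infinite emitter it is the part left for the improper vertices.\<close>

definition base_weight :: "('v, 'e) pre_digraph \<Rightarrow> 'e set \<Rightarrow> 'v \<Rightarrow> real" where
  "base_weight E A v = (if finite (out_arcs E v) \<and> out_arcs E v \<inter> A \<noteq> {} then 0 else 1)"

definition vertex_weight :: "('v, 'e) pre_digraph \<Rightarrow> 'e set \<Rightarrow> real \<Rightarrow> 'v \<Rightarrow> real" where
  "vertex_weight E A t = wfrec ((\<lambda>e. (head E e, tail E e)) ` A)
     (\<lambda>f v. base_weight E A v + t * (\<Sum>e\<in>out_arcs E v \<inter> A. f (head E e)))"

text \<open>A2 forces the weight of an improper vertex: it is the weight of \<open>v\<close> less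
  the contribution of the edges in \<open>Z\<close>. The constant 1 keeps it positive even if
  \<open>Z\<close> exhausts the edges of \<open>A\<close> leaving \<open>v\<close>.\<close>

fun symbol_weight :: "('v, 'e) pre_digraph \<Rightarrow> 'e set \<Rightarrow> real \<Rightarrow> ('v, 'e) vertex_symbol \<Rightarrow> real" where
  "symbol_weight E A t (Proper v) = vertex_weight E A t v"
| "symbol_weight E A t (Improper v Z) =
     1 + t * (\<Sum>e\<in>out_arcs E v \<inter> A - Z. vertex_weight E A t (head E e))"

definition weight :: "('v, 'e) pre_digraph \<Rightarrow> 'e set \<Rightarrow> real \<Rightarrow> ('v, 'e) formal_sum \<Rightarrow> real" where
  "weight E A t a = (\<Sum>(m, g)\<in>#a. t powi m * symbol_weight E A t g)"

lemma weight_add [simp]: "weight E A t (a + b) = weight E A t a + weight E A t b"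
  by (simp add: weight_def)

lemma weight_empty [simp]: "weight E A t {#} = 0"
  by (simp add: weight_def)

lemma weight_monomial [simp]: "weight E A t (monomial m g) = t powi m * symbol_weight E A t g"
  by (simp add: weight_def monomial_def)

lemma weight_sum: "weight E A t (\<Sum>e\<in>Z. f e) = (\<Sum>e\<in>Z. weight E A t (f e))"
  by (induction Z rule: infinite_finite_induct) auto

lemma weight_act:
  assumes "t > 0"
  shows "weight E A t (act n a) = t powi n * weight E A t a"
  using assms
  by (induction a) (auto simp: weight_def act_def power_int_add algebra_simps)

text \<open>This is the weight form of A3. As \<open>A\<close> contains \<open>W\<close>, every edge
  of \<open>W - Z\<close> is counted on the left. Allowing empty \<open>Z\<close> makes A2 a special
  case.\<close>

lemma symbol_weight_improper_split:
  assumes "infinite_emitter E v" "finite A" "Z \<subseteq> W" "W \<subseteq> out_arcs E v" "W \<subseteq> A"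
  shows "symbol_weight E A t (Improper v Z) =
    symbol_weight E A t (Improper v W) + t * (\<Sum>e\<in>W - Z. vertex_weight E A t (head E e))"
proof -
  have "out_arcs E v \<inter> A - Z = (out_arcs E v \<inter> A - W) \<union> (W - Z)" using assms by auto
  then show ?thesis
    using assms(2) finite_subset[OF assms(5,2)]
    by (simp add: sum.union_disjoint distrib_left Int_Diff disjoint_iff)
qed

locale finite_arcs_acyclic = wf_digraph G for G :: "('v, 'e) pre_digraph" +
  fixes A :: "'e set" and t :: real
  assumes acyclic: "acyclic_digraph G" and finite_A: "finite A" and A_arcs: "A \<subseteq> arcs G"
    and t_pos: "t > 0"
begin

lemma vertex_weight_rec:
  "vertex_weight G A t v =
     base_weight G A v + t * (\<Sum>e\<in>out_arcs G v \<inter> A. vertex_weight G A t (head G e))"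
proof -
  let ?R = "(\<lambda>e. (head G e, tail G e)) ` A"
  let ?F = "\<lambda>f v. base_weight G A v + t * (\<Sum>e\<in>out_arcs G v \<inter> A. f (head G e))"
  \<comment> \<open>The sum runs over edges of \<open>A\<close> only, so \<open>f\<close> is
    evaluated only below \<open>v\<close>.\<close>
  have "adm_wf ?R ?F"
    unfolding adm_wf_def by (auto intro!: sum.cong)
  from wfrec_fixpoint[OF wf_finite_arcs[OF acyclic finite_A A_arcs] this]
  show ?thesis unfolding vertex_weight_def by (rule fun_cong)
qed

text \<open>\<open>base_weight\<close> vanishes only if some edge of \<open>A\<close> leaves
  \<open>v\<close>, and then the sum is nonempty with terms positive by induction.\<close>

lemma vertex_weight_pos: "vertex_weight G A t v > 0"
proof (induction v rule: wf_induct_rule[OF wf_finite_arcs[OF acyclic finite_A A_arcs]])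
  case (1 v)
  have IH: "vertex_weight G A t (head G e) > 0" if "e \<in> out_arcs G v \<inter> A" for e
    using that 1 by force
  have fin: "finite (out_arcs G v \<inter> A)" using finite_A by simp
  show ?case
  proof (cases "out_arcs G v \<inter> A = {}")
    case True
    then show ?thesis by (subst vertex_weight_rec) (simp add: base_weight_def)
  next
    case False
    have "(\<Sum>e\<in>out_arcs G v \<inter> A. vertex_weight G A t (head G e)) > 0"
      using fin False IH by (rule sum_pos)
    moreover have "base_weight G A v \<ge> 0" by (simp add: base_weight_def)
    ultimately show ?thesis
      using t_pos by (subst vertex_weight_rec) (simp add: add_nonneg_pos)
  qed
qed

lemma symbol_weight_pos: "symbol_weight G A t g > 0"
proof (cases g)
  case (Improper v Z)
  have "(\<Sum>e\<in>out_arcs G v \<inter> A - Z. vertex_weight G A t (head G e)) \<ge> 0"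
    using vertex_weight_pos by (intro sum_nonneg) (simp add: less_imp_le)
  then show ?thesis using Improper t_pos by (simp add: add_pos_nonneg)
qed (use vertex_weight_pos in simp)

lemma weight_nonneg: "weight G A t a \<ge> 0"
  using symbol_weight_pos t_pos
  by (induction a) (auto simp: weight_def less_imp_le)

lemma weight_pos:
  assumes "a \<noteq> {#}"
  shows "weight G A t a > 0"
proof -
  obtain m g b where "a = b + monomial m g"
    using assms by (metis monomial_def multi_nonempty_split old.prod.exhaust add_mset_add_single)
  then show ?thesis
    using symbol_weight_pos t_pos weight_nonneg by (simp add: add_nonneg_pos)
qed

lemma vertex_weight_regular:
  assumes "regular_vertex G v" "out_arcs G v \<subseteq> A"
  shows "vertex_weight G A t v = t * (\<Sum>e\<in>out_arcs G v. vertex_weight G A t (head G e))"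
proof -
  have "out_arcs G v \<inter> A = out_arcs G v" using assms(2) by blast
  then show ?thesis
    using assms(1) by (subst vertex_weight_rec) (simp add: base_weight_def regular_vertex_def)
qed

lemma vertex_weight_emitter:
  assumes "infinite_emitter G v" "Z \<subseteq> out_arcs G v" "Z \<subseteq> A"
  shows "vertex_weight G A t v =
    symbol_weight G A t (Improper v Z) + t * (\<Sum>e\<in>Z. vertex_weight G A t (head G e))"
proof -
  \<comment> \<open>\<open>Improper v {}\<close> is not a generator; the formula for its weight
    merely agrees with the recursion at \<open>v\<close>, where \<open>base_weight\<close> is
    1.\<close>
  have "vertex_weight G A t v = symbol_weight G A t (Improper v {})"
    using assms(1) by (subst vertex_weight_rec) (simp add: base_weight_def infinite_emitter_def)
  then show ?thesis
    using symbol_weight_improper_split[OF assms(1) finite_A _ assms(2,3), of "{}"] by simp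
qed

end

section \<open>Invariance of weights under the congruence\<close>

context wf_digraph
begin

lemma weight_arrow1:
  assumes "arrow1 G a b" "acyclic_digraph G" "t > 0"
  shows "eventually (\<lambda>A. weight G A t a = weight G A t b) (finite_subsets_at_top (arcs G))"
proof -
  \<comment> \<open>The degree shift \<open>m + 1\<close> supplies the factor \<open>t\<close> of
    the recursion.\<close>
  have heads: "weight G A t (\<Sum>e\<in>Z. monomial (m + 1) (Proper (head G e))) =
      t powi m * (t * (\<Sum>e\<in>Z. vertex_weight G A t (head G e)))" for A Z m
    using assms(3) by (simp add: weight_sum sum_distrib_left power_int_add_1 mult.assoc)
  \<comment> \<open>\<open>D\<close> collects the edges that the relation mentions: all those
    leaving \<open>v\<close> for A1, \<open>Z\<close> for A2, \<open>W\<close> for A3.\<close>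
  obtain D where D: "finite D" "D \<subseteq> arcs G"
    and eq: "\<And>A. finite_arcs_acyclic G A t \<Longrightarrow> D \<subseteq> A \<Longrightarrow> weight G A t a = weight G A t b"
    using assms(1)
  proof cases
    case (A1 c v m)
    show ?thesis
    proof (rule that)
      show "finite (out_arcs G v)" "out_arcs G v \<subseteq> arcs G"
        using A1 by (auto simp: regular_vertex_def)
      show "weight G A t a = weight G A t b" if "finite_arcs_acyclic G A t" "out_arcs G v \<subseteq> A" for A
        using A1 finite_arcs_acyclic.vertex_weight_regular[OF that(1) _ that(2)] by (simp add: heads)
    qed
  next
    case (A2 c v Z m)
    show ?thesis
    proof (rule that)
      show "finite Z" "Z \<subseteq> arcs G" using A2 by auto
      show "weight G A t a = weight G A t b" if "finite_arcs_acyclic G A t" "Z \<subseteq> A" for A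
        using A2 finite_arcs_acyclic.vertex_weight_emitter[OF that(1) _ _ that(2)]
        by (simp add: heads distrib_left del: symbol_weight.simps(2))
    qed
  next
    case (A3 c v Z W m)
    show ?thesis
    proof (rule that)
      show "finite W" "W \<subseteq> arcs G" using A3 by auto
      show "weight G A t a = weight G A t b" if "finite_arcs_acyclic G A t" "W \<subseteq> A" for A
        using A3 symbol_weight_improper_split[OF _ finite_arcs_acyclic.finite_A[OF that(1)]
            _ _ that(2), of G v Z t]
        by (simp add: heads distrib_left del: symbol_weight.simps(2))
    qed
  qed
  show ?thesis
    unfolding eventually_finite_subsets_at_top
    using D eq assms(2,3) wf_digraph_axioms
    by (metis finite_arcs_acyclic.intro finite_arcs_acyclic_axioms.intro)
qed

text \<open>The two sides of each step agree for all large \<open>A\<close>, not just for one, so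
  the equalities along a derivation hold for a common \<open>A\<close>.\<close>

lemma weight_gcong:
  assumes "gcong G a b" "acyclic_digraph G" "t > 0"
  shows "eventually (\<lambda>A. weight G A t a = weight G A t b) (finite_subsets_at_top (arcs G))"
  using assms(1)
proof induction
  case (step a b)
  then show ?case using assms(2,3) by (rule weight_arrow1)
next
  case (sym a b)
  from sym.IH show ?case by eventually_elim simp
next
  case (trans a b c)
  from trans.IH show ?case by eventually_elim simp
next
  case (add a b c d)
  from add.IH show ?case by eventually_elim simp
next
  case (act a b n)
  from act.IH show ?case by eventually_elim (simp add: weight_act assms(3))
qed simp

lemma weight_precsim:
  assumes "precsim G a b" "acyclic_digraph G" "t > 0"
  obtains A where "finite_arcs_acyclic G A t" "weight G A t a \<le> weight G A t b"
proof -
  obtain c where "gcong G (a + c) b" using assms(1) unfolding precsim_def by blast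
  from weight_gcong[OF this assms(2,3)] obtain A where A: "finite A" "A \<subseteq> arcs G"
    and eq: "weight G A t (a + c) = weight G A t b"
    unfolding eventually_finite_subsets_at_top by blast
  interpret finite_arcs_acyclic G A t
    using assms(2,3) A by unfold_locales
  show thesis
    using that[OF finite_arcs_acyclic_axioms] eq weight_nonneg[of c] by simp
qed

lemma incomparable_if_acyclic:
  assumes "acyclic_digraph G" "a \<noteq> {#}"
  shows "incomparable G a"
  unfolding incomparable_def
proof (intro allI impI conjI notI)
  fix n :: nat assume n: "n > 0"
  show False if le: "precsim G a (act (int n) a)"
  proof -
    obtain A where A: "finite_arcs_acyclic G A (1/2)"
      and "weight G A (1/2) a \<le> (1/2) ^ n * weight G A (1/2) a"
      using weight_precsim[OF le assms(1), of "1/2"] by (auto simp: weight_act)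
    moreover have "(1/2 :: real) ^ n < 1" using n by (simp add: power_less_one_iff)
    ultimately show False using finite_arcs_acyclic.weight_pos[OF A assms(2)] by simp
  qed
  show False if le: "precsim G (act (int n) a) a"
  proof -
    obtain A where A: "finite_arcs_acyclic G A 2"
      and "2 ^ n * weight G A 2 a \<le> weight G A 2 a"
      using weight_precsim[OF le assms(1), of 2] by (auto simp: weight_act)
    moreover have "(2 :: real) ^ n > 1" using n by simp
    ultimately show False using finite_arcs_acyclic.weight_pos[OF A assms(2)] by simp
  qed
qed

lemma acyclic_if_incomparable:
  assumes "\<forall>g\<in>gens G. incomparable G (monomial 0 g)"
  shows "acyclic_digraph G"
  unfolding acyclic_digraph_def
proof
  assume "\<exists>p. cycle p"
  then obtain u p where p: "awalk u p u" "p \<noteq> []" unfolding cycle_def by blast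
  then have "Proper u \<in> gens G" by (auto simp: gens_def)
  then show False using assms not_incomparable_cycle[OF p] by blast
qed

end

theorem corollary5p7:
  fixes E :: "('v, 'e) pre_digraph"
  assumes "wf_digraph E"
  shows "((\<forall>a \<in> free_gamma_monoid E. a \<noteq> {#} \<longrightarrow> incomparable E a) \<longleftrightarrow>
          (\<forall>g \<in> gens E. incomparable E (monomial 0 g))) \<and>
         ((\<forall>g \<in> gens E. incomparable E (monomial 0 g)) \<longleftrightarrow> acyclic_digraph E)"
proof -
  interpret wf_digraph E by fact
  \<comment> \<open>The implications close a circle: (1) to (2) here, (2) to (3) by cycles, (3) to
    (1) by weights.\<close>
  have "incomparable E (monomial 0 g)"
    if "\<forall>a \<in> free_gamma_monoid E. a \<noteq> {#} \<longrightarrow> incomparable E a" "g \<in> gens E" for g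
    using that by (metis monomial_in_free_gamma_monoid monomial_def add_mset_not_empty)
  then show ?thesis
    using incomparable_if_acyclic acyclic_if_incomparable by metis
qed

end
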